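(* Let $D$ be a semi-regular (II) rectangular design with parameters $v=mn,b,r,k,\lambda_1,\lambda_2,\lambda_3,m,n$ with respect to the $m\times n$ array $A$, i.e. $\theta_2:=r-\lambda_2+(n-1)(\lambda_1-\lambda_3)=0$ while $\theta_1:=r-\lambda_1+(m-1)(\lambda_2-\lambda_3)>0$ and $\theta_3:=r-\lambda_1-\lambda_2+\lambda_3>0$. Then: (i) $m$ divides $k$, and if $\alpha=k/m$, then every block of $D$ contains exactly $\alpha$ treatments of each row of $A$; (ii) $D$ is uniform column tactical decomposable (with respect to the partition of the rows of its incidence matrix according to the rows of $A$); (iii) the dual of $D$ is $\alpha$-resolvable; (iv) if $D$ is self-dual, then it is $\alpha$-resolvable and square tactical decomposable STD$(n)$; (v) if $D$ is self-dual, then for each $s$ with $1\le s\le m-1$ there exists a semi-regular $\alpha$-resolvable rectangular design $D'$ with parameters $v'=(m-s)n$, $m'=m-s$, $n'=n$, $k'=\alpha(m-s)$ and the same $\lambda_1,\lambda_2,\lambda_3$.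
   Context: Let $m,n$ be positive integers and arrange $v=mn$ treatments in an $m\times n$ array $A$ (row $i$ consists of treatments $(i-1)n+1,\dots,in$). A rectangular design (RD) with parameters $v=mn,b,r,k,\lambda_1,\lambda_2,\lambda_3,m,n$ is a collection of $b$ blocks, each a set of $k$ distinct treatments, such that every treatment lies in exactly $r$ blocks, any two distinct treatments in the same row of $A$ occur together in exactly $\lambda_1$ blocks, any two in the same column of $A$ in exactly $\lambda_2$ blocks, and any other two distinct treatments in exactly $\lambda_3$ blocks. Its incidence matrix $N$ is the $v\times b$ $(0,1)$-matrix with rows ordered as in $A$. The dual of $D$ is the design with incidence matrix $N^T$; $D$ is self-dual if its dual is an RD with the same parameters (so $v=b$, $r=k$). A partition $N=[N_{ij}]$ into submatrices is column tactical if each $N_{ij}$ has constant column sums $k_{ij}$, row tactical if each $N_{ij}$ has constant row sums $r_{ij}$, and tactical if both; $D$ is uniform column tactical decomposable if there is a column tactical partition with all $k_{ij}$ equal. $D$ is square tactical decomposable STD$(n)$ if $N$ has a tactical partition into $n\times n$ submatrices. A design with $v$ treatments, $b$ blocks of size $k$, replication $r$ is $\alpha$-resolvable if its blocks can be partitioned into $r/\alpha$ classes of $v\alpha/k$ blocks each such that every treatment occurs in exactly $\alpha$ blocks of each class (equivalently $N=(N_1|\cdots|N_{r/\alpha})$ with every row sum of each $N_i$ equal to $\alpha$). *)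

theory Defs
  imports Jordan_Normal_Form.Matrix "HOL-Library.Disjoint_Sets" "HOL-Library.Multiset"
begin

text \<open>
  The \<open>v\<close> treatments are \<open>0, \<dots>, v - 1\<close>, and a design is the list of its blocks (blocks may be
  repeated; the order of the list fixes the order of the columns of the incidence matrix).
  In the \<open>m \<times> n\<close> array, treatment \<open>t\<close> stands in row \<open>t div n\<close> and column \<open>t mod n\<close>.
\<close>

definition block_design :: "nat \<Rightarrow> nat \<Rightarrow> nat \<Rightarrow> nat \<Rightarrow> nat set list \<Rightarrow> bool" where
  "block_design v b r k D \<longleftrightarrow>
     length D = b \<and>
     (\<forall>B\<in>set D. B \<subseteq> {..<v} \<and> card B = k) \<and>
     (\<forall>x<v. length (filter (\<lambda>B. x \<in> B) D) = r)"

definition concurrence :: "nat set list \<Rightarrow> nat \<Rightarrow> nat \<Rightarrow> nat" where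
  "concurrence D x y = length (filter (\<lambda>B. x \<in> B \<and> y \<in> B) D)"

definition rectangular_design ::
  "nat \<Rightarrow> nat \<Rightarrow> nat \<Rightarrow> nat \<Rightarrow> nat \<Rightarrow> nat \<Rightarrow> nat \<Rightarrow> nat \<Rightarrow> nat \<Rightarrow> nat set list \<Rightarrow> bool" where
  "rectangular_design v b r k l1 l2 l3 m n D \<longleftrightarrow>
     m > 0 \<and> n > 0 \<and> v = m * n \<and> block_design v b r k D \<and>
     (\<forall>x<v. \<forall>y<v. x \<noteq> y \<longrightarrow>
        concurrence D x y =
          (if x div n = y div n then l1 else if x mod n = y mod n then l2 else l3))"

definition theta1 :: "nat \<Rightarrow> nat \<Rightarrow> nat \<Rightarrow> nat \<Rightarrow> nat \<Rightarrow> int" where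
  "theta1 r l1 l2 l3 m = int r - int l1 + (int m - 1) * (int l2 - int l3)"

definition theta2 :: "nat \<Rightarrow> nat \<Rightarrow> nat \<Rightarrow> nat \<Rightarrow> nat \<Rightarrow> int" where
  "theta2 r l1 l2 l3 n = int r - int l2 + (int n - 1) * (int l1 - int l3)"

definition theta3 :: "nat \<Rightarrow> nat \<Rightarrow> nat \<Rightarrow> nat \<Rightarrow> int" where
  "theta3 r l1 l2 l3 = int r - int l1 - int l2 + int l3"

definition semi_regular_II_RD ::
  "nat \<Rightarrow> nat \<Rightarrow> nat \<Rightarrow> nat \<Rightarrow> nat \<Rightarrow> nat \<Rightarrow> nat \<Rightarrow> nat \<Rightarrow> nat \<Rightarrow> nat set list \<Rightarrow> bool" where
  "semi_regular_II_RD v b r k l1 l2 l3 m n D \<longleftrightarrow>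
     rectangular_design v b r k l1 l2 l3 m n D \<and>
     theta2 r l1 l2 l3 n = 0 \<and> theta1 r l1 l2 l3 m > 0 \<and> theta3 r l1 l2 l3 > 0"

definition incidence_matrix :: "nat \<Rightarrow> nat set list \<Rightarrow> nat mat" where
  "incidence_matrix v D = mat v (length D) (\<lambda>(i, j). if i \<in> D ! j then 1 else 0)"

definition design_of_matrix :: "nat mat \<Rightarrow> nat set list" where
  "design_of_matrix N = map (\<lambda>j. {i. i < dim_row N \<and> N $$ (i, j) = 1}) [0..<dim_col N]"

definition dual_design :: "nat \<Rightarrow> nat set list \<Rightarrow> nat set list" where
  "dual_design v D = design_of_matrix (transpose_mat (incidence_matrix v D))"

lemma incidence_matrix_dual_design:
  "incidence_matrix (length D) (dual_design v D) = transpose_mat (incidence_matrix v D)"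
  by (rule eq_matI)
     (auto simp: incidence_matrix_def dual_design_def design_of_matrix_def)

text \<open>
  The blocks of a design come in no particular order, so the arrangement of the blocks of \<open>D\<close>
  (the treatments of the dual) in an \<open>m \<times> n\<close> array may be any; it is given by the
  reordering \<open>E\<close> of \<open>D\<close>.
\<close>

definition self_dual_RD ::
  "nat \<Rightarrow> nat \<Rightarrow> nat \<Rightarrow> nat \<Rightarrow> nat \<Rightarrow> nat \<Rightarrow> nat \<Rightarrow> nat \<Rightarrow> nat \<Rightarrow> nat set list \<Rightarrow> bool" where
  "self_dual_RD v b r k l1 l2 l3 m n D \<longleftrightarrow>
     rectangular_design v b r k l1 l2 l3 m n D \<and>
     (\<exists>E. mset E = mset D \<and>
        rectangular_design v b r k l1 l2 l3 m n (dual_design v E))"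

text \<open>
  A partition of \<open>N\<close> into submatrices is given by a partition \<open>P\<close> of the row indices and a
  partition \<open>Q\<close> of the column indices; \<open>R \<in> P\<close> and \<open>C \<in> Q\<close> determine the submatrix with rows
  \<open>R\<close> and columns \<open>C\<close>.
\<close>

definition matrix_partition :: "nat mat \<Rightarrow> nat set set \<Rightarrow> nat set set \<Rightarrow> bool" where
  "matrix_partition N P Q \<longleftrightarrow> partition_on {..<dim_row N} P \<and> partition_on {..<dim_col N} Q"

definition column_tactical ::
  "nat mat \<Rightarrow> nat set set \<Rightarrow> nat set set \<Rightarrow> (nat set \<Rightarrow> nat set \<Rightarrow> nat) \<Rightarrow> bool" where
  "column_tactical N P Q \<kappa> \<longleftrightarrow> matrix_partition N P Q \<and>
     (\<forall>R\<in>P. \<forall>C\<in>Q. \<forall>j\<in>C. (\<Sum>i\<in>R. N $$ (i, j)) = \<kappa> R C)"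

definition row_tactical ::
  "nat mat \<Rightarrow> nat set set \<Rightarrow> nat set set \<Rightarrow> (nat set \<Rightarrow> nat set \<Rightarrow> nat) \<Rightarrow> bool" where
  "row_tactical N P Q \<rho> \<longleftrightarrow> matrix_partition N P Q \<and>
     (\<forall>R\<in>P. \<forall>C\<in>Q. \<forall>i\<in>R. (\<Sum>j\<in>C. N $$ (i, j)) = \<rho> R C)"

definition tactical :: "nat mat \<Rightarrow> nat set set \<Rightarrow> nat set set \<Rightarrow> bool" where
  "tactical N P Q \<longleftrightarrow> (\<exists>\<kappa>. column_tactical N P Q \<kappa>) \<and> (\<exists>\<rho>. row_tactical N P Q \<rho>)"

definition array_row :: "nat \<Rightarrow> nat \<Rightarrow> nat set" where
  "array_row n i = {i * n..<(i + 1) * n}"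

definition array_rows :: "nat \<Rightarrow> nat \<Rightarrow> nat set set" where
  "array_rows m n = array_row n ` {..<m}"

definition uniform_column_tactical_decomposable_wrt ::
  "nat set set \<Rightarrow> nat \<Rightarrow> nat set list \<Rightarrow> bool" where
  "uniform_column_tactical_decomposable_wrt P v D \<longleftrightarrow>
     (\<exists>Q \<kappa> c. column_tactical (incidence_matrix v D) P Q \<kappa> \<and> (\<forall>R\<in>P. \<forall>C\<in>Q. \<kappa> R C = c))"

text \<open>
  The rows of the incidence matrix are ordered as in the array, so the groups of \<open>n\<close> consecutive
  rows are the rows of the array. The columns carry no prescribed order, so their groups are
  arbitrary sets of \<open>n\<close> columns.
\<close>

definition STD :: "nat \<Rightarrow> nat \<Rightarrow> nat set list \<Rightarrow> bool" where
  "STD m n D \<longleftrightarrow>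
     (\<exists>Q. tactical (incidence_matrix (m * n) D) (array_rows m n) Q \<and> (\<forall>C\<in>Q. card C = n))"

text \<open>
  The classes are sets of positions in the list \<open>D\<close>. The two cardinality equations say that there
  are \<open>r / \<alpha>\<close> classes of \<open>v \<alpha> / k\<close> blocks each.
\<close>

definition resolvable :: "nat \<Rightarrow> nat \<Rightarrow> nat \<Rightarrow> nat \<Rightarrow> nat \<Rightarrow> nat set list \<Rightarrow> bool" where
  "resolvable \<alpha> v b r k D \<longleftrightarrow> block_design v b r k D \<and> \<alpha> > 0 \<and>
     (\<exists>Q. partition_on {..<b} Q \<and> card Q * \<alpha> = r \<and>
        (\<forall>C\<in>Q. card C * k = v * \<alpha> \<and> (\<forall>x<v. card {j\<in>C. x \<in> D ! j} = \<alpha>)))"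

end

theory Submission
  imports Defs "HOL-Combinatorics.List_Permutation"
begin

text \<open>
  Let \<open>a\<^sub>i(B)\<close> be the number of treatments of row \<open>i\<close> of the array in the block \<open>B\<close>. Counting
  concurrences, \<open>\<Sum>\<^sub>B (a\<^sub>i(B) - a\<^sub>j(B))\<^sup>2 = 2 n \<theta>\<^sub>2\<close> for distinct rows \<open>i\<close> and \<open>j\<close>. Hence
  \<open>\<theta>\<^sub>2 = 0\<close> forces every block to meet all rows in equally many treatments, which gives (i) to (iii).
  If \<open>D\<close> is self-dual, the same applies to its dual, so that the rows of the array of blocks are
  resolution classes. For (v) delete the last \<open>s\<close> rows of the array from all blocks; if
  \<open>\<lambda>\<^sub>2 \<ge> \<lambda>\<^sub>3\<close> then \<open>\<theta>\<^sub>1'\<close> is positive because \<open>\<theta>\<^sub>3\<close> is, and otherwise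
  because \<open>\<theta>\<^sub>1' > \<theta>\<^sub>1\<close>.
\<close>

section \<open>The rows of the array\<close>

text \<open>Translates the interval form of a row into the \<open>div\<close> coordinate used by
  \<open>rectangular_design\<close>; disjointness and covering of the rows then become
  arithmetic.\<close>

lemma mem_array_row_iff: "n > 0 \<Longrightarrow> x \<in> array_row n i \<longleftrightarrow> x div n = i"
  unfolding array_row_def
  by (auto simp: div_nat_eqI dividend_less_times_div mult.commute intro: div_nat_eqI)

lemma finite_array_row [simp]: "finite (array_row n i)"
  by (simp add: array_row_def)

lemma card_array_row [simp]: "card (array_row n i) = n"
  by (simp add: array_row_def)

lemma array_row_subset: "i < m \<Longrightarrow> array_row n i \<subseteq> {..<m * n}"
  unfolding array_row_def using mult_le_mono1[of "i + 1" m n] by fastforce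

lemma inj_array_row: "n > 0 \<Longrightarrow> inj (array_row n)"
  by (rule injI) (metis card_array_row card_gt_0_iff ex_in_conv mem_array_row_iff)

lemma card_array_rows: "n > 0 \<Longrightarrow> card (array_rows m n) = m"
  unfolding array_rows_def
  by (subst card_image) (auto intro: inj_on_subset[OF inj_array_row])

lemma Union_array_rows:
  assumes "n > 0"
  shows "\<Union> (array_rows m n) = {..<m * n}"
proof
  show "\<Union> (array_rows m n) \<subseteq> {..<m * n}"
    using array_row_subset unfolding array_rows_def by blast
  show "{..<m * n} \<subseteq> \<Union> (array_rows m n)"
    using assms by (auto simp: array_rows_def mem_array_row_iff less_mult_imp_div_less)
qed

lemma partition_on_array_rows:
  assumes "n > 0"
  shows "partition_on {..<m * n} (array_rows m n)"
proof (rule partition_onI)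
  show "\<Union> (array_rows m n) = {..<m * n}"
    using assms by (rule Union_array_rows)
  show "disjnt p q" if "p \<in> array_rows m n" "q \<in> array_rows m n" "p \<noteq> q" for p q
    using that assms by (auto simp: array_rows_def disjnt_iff mem_array_row_iff)
  show "{} \<notin> array_rows m n"
    using assms by (auto simp: array_rows_def array_row_def)
qed

section \<open>Double counting\<close>

lemma sum_list_card_Int:
  assumes "finite S"
  shows "(\<Sum>B\<leftarrow>D. card (B \<inter> S)) = (\<Sum>x\<in>S. length (filter (\<lambda>B. x \<in> B) D))"
proof (induction D)
  case (Cons B D)
  have "card (B \<inter> S) = (\<Sum>x\<in>S. of_bool (x \<in> B))"
    using assms by (simp add: Int_commute)
  moreover have "length (filter (\<lambda>B. x \<in> B) (B # D))
      = of_bool (x \<in> B) + length (filter (\<lambda>B. x \<in> B) D)" for x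
    by simp
  ultimately show ?case
    using Cons.IH by (simp only: sum.distrib list.map sum_list.Cons)
qed simp

text \<open>Both sides count the triples of a block position, an element of \<open>S\<close> and an
  element of \<open>T\<close> lying in that block. Pairs with \<open>x = y\<close> are included; for
  them \<open>concurrence\<close> is the replication number.\<close>

lemma sum_list_card_Int_mult:
  assumes "finite S" "finite T"
  shows "(\<Sum>B\<leftarrow>D. card (B \<inter> S) * card (B \<inter> T)) = (\<Sum>x\<in>S. \<Sum>y\<in>T. concurrence D x y)"
proof (induction D)
  case (Cons B D)
  have "card (B \<inter> S) * card (B \<inter> T)
      = (\<Sum>x\<in>S. of_bool (x \<in> B)) * (\<Sum>y\<in>T. of_bool (y \<in> B))"
    using assms by (simp add: Int_commute)
  also have "\<dots> = (\<Sum>x\<in>S. \<Sum>y\<in>T. of_bool (x \<in> B \<and> y \<in> B))"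
    by (simp only: sum_product of_bool_conj)
  finally have "card (B \<inter> S) * card (B \<inter> T) = (\<Sum>x\<in>S. \<Sum>y\<in>T. of_bool (x \<in> B \<and> y \<in> B))" .
  moreover have "concurrence (B # D) x y = of_bool (x \<in> B \<and> y \<in> B) + concurrence D x y" for x y
    by (simp add: concurrence_def)
  ultimately show ?case
    using Cons.IH by (simp only: sum.distrib list.map sum_list.Cons)
qed (simp add: concurrence_def)

lemma block_design_count:
  assumes "block_design v b r k D"
  shows "v * r = b * k"
proof -
  have "map (\<lambda>B. card (B \<inter> {..<v})) D = map (\<lambda>_. k) D"
    using assms by (auto simp: block_design_def Int_absorb2)
  then have "(\<Sum>B\<leftarrow>D. card (B \<inter> {..<v})) = b * k"
    using assms by (simp only:) (simp add: block_design_def sum_list_triv)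
  moreover have "(\<Sum>x<v. length (filter (\<lambda>B. x \<in> B) D)) = v * r"
    using assms by (simp add: block_design_def)
  ultimately show ?thesis
    using sum_list_card_Int[of "{..<v}" D] by simp
qed

text \<open>Exactly one treatment of row \<open>i\<close> shares the column of \<open>x\<close>. It
  contributes \<open>r\<close> if it is \<open>x\<close> itself and \<open>l2\<close> otherwise; the
  remaining \<open>n - 1\<close> contribute \<open>l1\<close> or \<open>l3\<close> each.\<close>

lemma rectangular_design_row_sum:
  assumes D: "rectangular_design v b r k l1 l2 l3 m n D" and x: "x < v" and i: "i < m"
  shows "(\<Sum>y\<in>array_row n i. concurrence D x y)
    = (if x div n = i then r + (n - 1) * l1 else l2 + (n - 1) * l3)"
proof -
  have n: "n > 0" and v: "v = m * n"
    and conc: "\<And>y. y < v \<Longrightarrow> x \<noteq> y \<Longrightarrow> concurrence D x y =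
          (if x div n = y div n then l1 else if x mod n = y mod n then l2 else l3)"
    and self: "concurrence D x x = r"
    using D x by (auto simp: rectangular_design_def block_design_def concurrence_def)
  \<comment> \<open>The treatment of row \<open>i\<close> in the column of \<open>x\<close>.\<close>
  define z where "z = i * n + x mod n"
  have z_div: "z div n = i" and z_mod: "z mod n = x mod n"
    using n by (auto simp: z_def)
  have z_in: "z \<in> array_row n i"
    using n z_div by (simp add: mem_array_row_iff)
  have lt: "y < v" if "y \<in> array_row n i" for y
    using that array_row_subset[OF i] v by blast
  have split: "(\<Sum>y\<in>array_row n i. concurrence D x y)
      = concurrence D x z + (\<Sum>y\<in>array_row n i - {z}. concurrence D x y)"
    using z_in by (simp add: sum.remove)
  have card: "card (array_row n i - {z}) = n - 1"
    using z_in by simp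
  have ne: "y mod n \<noteq> x mod n" if "y \<in> array_row n i - {z}" for y
    using that n by (auto simp: mem_array_row_iff z_def) (metis div_mult_mod_eq)
  show ?thesis
  proof (cases "x div n = i")
    case True
    then have "z = x"
      by (metis z_def div_mult_mod_eq)
    moreover have "(\<Sum>y\<in>array_row n i - {z}. concurrence D x y) = (\<Sum>y\<in>array_row n i - {z}. l1)"
      using True n \<open>z = x\<close> by (intro sum.cong) (auto simp: conc lt mem_array_row_iff)
    ultimately show ?thesis
      using True split card self by simp
  next
    case False
    then have "concurrence D x z = l2"
      using conc[OF lt[OF z_in]] z_div z_mod by auto
    moreover have "(\<Sum>y\<in>array_row n i - {z}. concurrence D x y) = (\<Sum>y\<in>array_row n i - {z}. l3)"
    proof (intro sum.cong refl)
      fix y assume y: "y \<in> array_row n i - {z}"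
      then have "y div n = i"
        using n by (simp add: mem_array_row_iff)
      with False y ne[OF y] show "concurrence D x y = l3"
        using conc[of y] lt[of y] by auto
    qed
    ultimately show ?thesis
      using False split card by simp
  qed
qed

text \<open>The row sums of concurrences do not depend on the chosen treatment of row
  \<open>i\<close>, so its \<open>n\<close> treatments contribute equally. The two possible values
  differ by \<open>n\<close> times \<open>theta2\<close>.\<close>

lemma rectangular_design_sum_row_counts:
  assumes D: "rectangular_design v b r k l1 l2 l3 m n D" and ij: "i < m" "j < m"
  shows "(\<Sum>B\<leftarrow>D. card (B \<inter> array_row n i) * card (B \<inter> array_row n j))
    = n * (if i = j then r + (n - 1) * l1 else l2 + (n - 1) * l3)"
proof -
  have n: "n > 0" and v: "v = m * n"
    using D by (auto simp: rectangular_design_def)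
  have "(\<Sum>y\<in>array_row n j. concurrence D x y)
      = (if i = j then r + (n - 1) * l1 else l2 + (n - 1) * l3)" if "x \<in> array_row n i" for x
  proof -
    have "x < v" "x div n = i"
      using that array_row_subset[OF ij(1), of n] v n mem_array_row_iff[OF n] by blast+
    then show ?thesis
      using rectangular_design_row_sum[OF D _ ij(2)] by simp
  qed
  then show ?thesis
    by (simp add: sum_list_card_Int_mult)
qed

section \<open>Semi-regular designs\<close>

lemma semi_regular_II_RD_card_Int_row_eq:
  assumes D: "semi_regular_II_RD v b r k l1 l2 l3 m n D" and B: "B \<in> set D"
    and ij: "i < m" "j < m"
  shows "card (B \<inter> array_row n i) = card (B \<inter> array_row n j)"
proof (cases "i = j")
  case False
  have RD: "rectangular_design v b r k l1 l2 l3 m n D" and "theta2 r l1 l2 l3 n = 0" and n: "n > 0"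
    using D by (auto simp: semi_regular_II_RD_def rectangular_design_def)
  \<comment> \<open>\<open>theta2 = 0\<close> says precisely that the row sums for
    \<open>i = j\<close> and for distinct \<open>i\<close>, \<open>j\<close> coincide.\<close>
  then have "int (r + (n - 1) * l1) = int (l2 + (n - 1) * l3)"
    by (simp add: theta2_def right_diff_distrib of_nat_diff)
  then have eq: "r + (n - 1) * l1 = l2 + (n - 1) * l3"
    by (simp only: of_nat_eq_iff)
  let ?a = "\<lambda>i B. card (B \<inter> array_row n i)"
  let ?S = "\<lambda>i j. \<Sum>B\<leftarrow>D. ?a i B * ?a j B"
  \<comment> \<open>The squares are formed in \<open>int\<close>, where subtraction is not
    truncated; a vanishing sum of squares then kills every term.\<close>
  have "(\<Sum>B\<leftarrow>D. (int (?a i B) - int (?a j B))\<^sup>2) = int (?S i i) + int (?S j j) - 2 * int (?S i j)"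
    by (induction D) (simp_all add: power2_eq_square algebra_simps)
  also have "\<dots> = 0"
    using rectangular_design_sum_row_counts[OF RD] ij False eq by simp
  finally have "(int (?a i B) - int (?a j B))\<^sup>2 = 0"
    using B by (subst (asm) sum_list_nonneg_eq_0_iff) auto
  then show ?thesis
    by simp
qed simp

lemma card_eq_sum_array_rows:
  assumes "B \<subseteq> {..<m * n}" "n > 0"
  shows "card B = (\<Sum>i<m. card (B \<inter> array_row n i))"
proof -
  have "B = (\<Union>i<m. B \<inter> array_row n i)"
    using assms Union_array_rows[of n m] by (auto simp: array_rows_def)
  moreover have "card (\<Union>i<m. B \<inter> array_row n i) = (\<Sum>i<m. card (B \<inter> array_row n i))"
    using assms by (intro card_UN_disjoint) (auto simp: mem_array_row_iff)
  ultimately show ?thesis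
    by simp
qed

text \<open>The rows cut a block into \<open>m\<close> pieces of equal size. The product form yields
  both divisibility by \<open>m\<close> and the value of the quotient.\<close>

lemma semi_regular_II_RD_block_rows:
  assumes D: "semi_regular_II_RD v b r k l1 l2 l3 m n D" and B: "B \<in> set D" and i: "i < m"
  shows "card (B \<inter> array_row n i) * m = k"
proof -
  have n: "n > 0" and "B \<subseteq> {..<m * n}" "card B = k"
    using D B by (auto simp: semi_regular_II_RD_def rectangular_design_def block_design_def)
  then have "k = (\<Sum>j<m. card (B \<inter> array_row n j))"
    using card_eq_sum_array_rows by blast
  also have "\<dots> = (\<Sum>j<m. card (B \<inter> array_row n i))"
    using semi_regular_II_RD_card_Int_row_eq[OF D B _ i] by (intro sum.cong) auto
  finally show ?thesis
    by (simp add: mult.commute)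
qed

text \<open>Through \<open>v * r = b * k\<close> this guarantees that blocks exist and are nonempty:
  \<open>m dvd k\<close> needs a block to count in, and a resolution needs \<alpha> positive. If
  \<open>r = 0\<close>, then \<open>theta2 = 0\<close> makes \<open>theta1\<close> or
  \<open>theta3\<close> nonpositive.\<close>

lemma semi_regular_II_RD_r_pos:
  assumes D: "semi_regular_II_RD v b r k l1 l2 l3 m n D"
  shows "r > 0"
proof (rule ccontr)
  assume "\<not> r > 0"
  then have r: "r = 0"
    by simp
  have RD: "rectangular_design v b r k l1 l2 l3 m n D" and m: "m > 0" and n: "n > 0"
    and v: "v = m * n"
    and t: "theta2 r l1 l2 l3 n = 0" "theta1 r l1 l2 l3 m > 0" "theta3 r l1 l2 l3 > 0"
    using D by (auto simp: semi_regular_II_RD_def rectangular_design_def)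
  show False
  proof (cases "n = 1")
    \<comment> \<open>With one column no two treatments share a row, so \<open>l1\<close> is
      unconstrained; here \<open>theta2 = 0\<close> reads \<open>l2 = r\<close>, and
      \<open>theta1\<close> gives the contradiction.\<close>
    case True
    then have "l2 = 0"
      using t(1) r by (simp add: theta2_def)
    moreover have "(int m - 1) * int l3 \<ge> 0"
      using m by simp
    ultimately show False
      using t(2) r by (simp add: theta1_def)
  next
    case False
    then have n2: "n \<ge> 2"
      using n by simp
    have v2: "1 < v"
      using n2 m v by (metis One_nat_def Suc_le_eq mult_le_mono nat_mult_1 numeral_2_eq_2)
    \<comment> \<open>Treatments 0 and 1 both lie in the first row, since \<open>n\<close> is at
      least 2.\<close>
    then have "concurrence D 0 1 = l1"
      using RD n2 by (simp add: rectangular_design_def)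
    moreover have "filter (\<lambda>B. 0 \<in> B) D = []"
      using RD r v2 by (simp add: rectangular_design_def block_design_def)
    then have "concurrence D 0 1 = 0"
      by (auto simp: concurrence_def filter_empty_conv)
    ultimately have l1: "l1 = 0"
      by simp
    have "int l2 + (int n - 1) * int l3 = 0"
      using t(1) r l1 by (simp add: theta2_def algebra_simps)
    moreover have "(int n - 1) * int l3 \<ge> 1 * int l3"
      using n2 by (intro mult_right_mono) auto
    ultimately have "l3 = 0"
      by simp
    then show False
      using t(3) r l1 by (simp add: theta3_def)
  qed
qed

lemma semi_regular_II_RD_pos:
  assumes D: "semi_regular_II_RD v b r k l1 l2 l3 m n D"
  shows "b > 0" "k > 0"
proof -
  have "v * r = b * k" "v > 0"
    using D block_design_count by (auto simp: semi_regular_II_RD_def rectangular_design_def)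
  then show "b > 0" "k > 0"
    using semi_regular_II_RD_r_pos[OF D] by (metis gr0I mult_is_0 less_not_refl)+
qed

text \<open>A block exists because \<open>b > 0\<close>; its count in any row is the
  cofactor.\<close>

lemma semi_regular_II_RD_dvd:
  assumes D: "semi_regular_II_RD v b r k l1 l2 l3 m n D"
  shows "m dvd k"
proof -
  have "D \<noteq> []" "m > 0"
    using D semi_regular_II_RD_pos(1)[OF D]
    by (auto simp: semi_regular_II_RD_def rectangular_design_def block_design_def)
  then show ?thesis
    using semi_regular_II_RD_block_rows[OF D hd_in_set] by (metis dvd_triv_right)
qed

lemma semi_regular_II_RD_alpha:
  assumes D: "semi_regular_II_RD v b r k l1 l2 l3 m n D"
  shows "k div m > 0" "m * (k div m) = k"
    and "\<And>B i. B \<in> set D \<Longrightarrow> i < m \<Longrightarrow> card (B \<inter> array_row n i) = k div m"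
proof -
  have m: "m > 0"
    using D by (simp add: semi_regular_II_RD_def rectangular_design_def)
  show *: "m * (k div m) = k"
    using semi_regular_II_RD_dvd[OF D] by simp
  show "k div m > 0"
    using * semi_regular_II_RD_pos(2)[OF D] by (metis gr0I mult_0_right less_not_refl)
  show "card (B \<inter> array_row n i) = k div m" if "B \<in> set D" "i < m" for B i
    using semi_regular_II_RD_block_rows[OF D that] m by auto
qed

section \<open>Row and column sums of the incidence matrix\<close>

lemma incidence_matrix_col_sum:
  assumes "R \<subseteq> {..<v}" "j < length D"
  shows "(\<Sum>i\<in>R. incidence_matrix v D $$ (i, j)) = card (D ! j \<inter> R)"
proof -
  have "(\<Sum>i\<in>R. incidence_matrix v D $$ (i, j)) = (\<Sum>i\<in>R. of_bool (i \<in> D ! j))"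
    using assms by (intro sum.cong) (auto simp: incidence_matrix_def)
  then show ?thesis
    using assms(1) finite_subset by (fastforce simp: Int_commute)
qed

lemma incidence_matrix_row_sum:
  assumes "C \<subseteq> {..<length D}" "i < v"
  shows "(\<Sum>j\<in>C. incidence_matrix v D $$ (i, j)) = card {j \<in> C. i \<in> D ! j}"
proof -
  have "finite C"
    using assms(1) finite_subset by blast
  moreover have "(\<Sum>j\<in>C. incidence_matrix v D $$ (i, j)) = (\<Sum>j\<in>C. of_bool (i \<in> D ! j))"
    using assms by (intro sum.cong) (auto simp: incidence_matrix_def)
  ultimately show ?thesis
    by (simp add: Int_def)
qed

text \<open>The condition concerns one column at a time, so it holds for every partition
  \<open>Q\<close> of the columns. This freedom serves (ii) with a single class and (iv) with the
  resolution classes.\<close>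

lemma semi_regular_II_RD_column_tactical:
  assumes D: "semi_regular_II_RD v b r k l1 l2 l3 m n D" and Q: "partition_on {..<b} Q"
  shows "column_tactical (incidence_matrix v D) (array_rows m n) Q (\<lambda>_ _. k div m)"
proof -
  have n: "n > 0" and v: "v = m * n" and b: "length D = b"
    using D by (auto simp: semi_regular_II_RD_def rectangular_design_def block_design_def)
  have "(\<Sum>x\<in>array_row n i. incidence_matrix v D $$ (x, j)) = k div m"
    if "i < m" "C \<in> Q" "j \<in> C" for i j C
  proof -
    have "j < length D"
      using that Q b by (auto simp: partition_on_def)
    then show ?thesis
      using that(1) array_row_subset[OF that(1), of n] v semi_regular_II_RD_alpha(3)[OF D]
      by (simp add: incidence_matrix_col_sum)
  qed
  then show ?thesis
    using partition_on_array_rows[OF n, of m] Q v b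
    by (auto simp: column_tactical_def matrix_partition_def array_rows_def incidence_matrix_def)
qed

section \<open>Duality\<close>

lemma length_dual_design [simp]: "length (dual_design v D) = v"
  by (simp add: dual_design_def design_of_matrix_def incidence_matrix_def)

lemma nth_dual_design:
  "x < v \<Longrightarrow> dual_design v D ! x = {j. j < length D \<and> x \<in> D ! j}"
  by (auto simp: dual_design_def design_of_matrix_def incidence_matrix_def split: if_splits)

text \<open>Transposing the incidence matrix exchanges row sums with column sums, hence
  \<open>v\<close> with \<open>b\<close> and \<open>r\<close> with \<open>k\<close>.\<close>

lemma block_design_dual_design:
  assumes "block_design v b r k D"
  shows "block_design b v k r (dual_design v D)"
proof -
  have b: "length D = b"
    using assms by (simp add: block_design_def)
  have "B \<subseteq> {..<b} \<and> card B = r" if "B \<in> set (dual_design v D)" for B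
  proof -
    obtain x where "x < v" "B = {j. j < b \<and> x \<in> D ! j}"
      using \<open>B \<in> set (dual_design v D)\<close> b by (auto simp: in_set_conv_nth nth_dual_design)
    then show ?thesis
      using assms by (auto simp: block_design_def length_filter_conv_card)
  qed
  moreover have "length (filter (\<lambda>B. j \<in> B) (dual_design v D)) = k" if "j < b" for j
  proof -
    have Dj: "D ! j \<subseteq> {..<v}" "card (D ! j) = k"
      using assms that b by (auto simp: block_design_def)
    have "{i. i < length (dual_design v D) \<and> j \<in> dual_design v D ! i} = D ! j"
      using Dj(1) that b by (auto simp: nth_dual_design)
    then show ?thesis
      using Dj(2) by (simp only: length_filter_conv_card)
  qed
  ultimately show ?thesis
    by (simp add: block_design_def)
qed

text \<open>The classes are the rows of the array. A block meeting each row in \<alpha> treatments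
  becomes, in the dual, a treatment lying in \<alpha> blocks of each class.\<close>

lemma semi_regular_II_RD_dual_resolvable:
  assumes D: "semi_regular_II_RD v b r k l1 l2 l3 m n D"
  shows "resolvable (k div m) b v k r (dual_design v D)"
proof -
  have n: "n > 0" and m: "m > 0" and v: "v = m * n" and BD: "block_design v b r k D"
    and b: "length D = b"
    using D by (auto simp: semi_regular_II_RD_def rectangular_design_def block_design_def)
  note \<alpha> = semi_regular_II_RD_alpha[OF D]
  have "m * (n * r) = m * (b * (k div m))"
    using block_design_count[OF BD] v \<alpha>(2) by (metis mult.assoc mult.left_commute)
  then have size: "n * r = b * (k div m)"
    using m by simp
  have "card {x \<in> array_row n i. j \<in> dual_design v D ! x} = k div m" if "i < m" "j < b" for i j
  proof -
    have "{x \<in> array_row n i. j \<in> dual_design v D ! x} = D ! j \<inter> array_row n i"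
      using array_row_subset[OF that(1), of n] that(2) v b by (auto simp: nth_dual_design)
    then show ?thesis
      using \<alpha>(3) that b by simp
  qed
  then have "\<forall>C\<in>array_rows m n. card C * r = b * (k div m) \<and>
      (\<forall>j<b. card {x \<in> C. j \<in> dual_design v D ! x} = k div m)"
    using size by (auto simp: array_rows_def)
  then show ?thesis
    unfolding resolvable_def
    using block_design_dual_design[OF BD] \<alpha>(1,2) partition_on_array_rows[OF n, of m]
      card_array_rows[OF n, of m] v by metis
qed

text \<open>The conditions on the thetas involve only the parameters, so the dual is semi-regular
  too. Its blocks correspond to the treatments of \<open>D\<close>, and each meets every row of the
  array of blocks in \<alpha> points; these rows give the classes.\<close>

lemma self_dual_RD_resolution:
  assumes D: "semi_regular_II_RD v b r k l1 l2 l3 m n D"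
    and dual: "self_dual_RD v b r k l1 l2 l3 m n D"
  obtains Q where "partition_on {..<b} Q" "card Q = m" "\<And>C. C \<in> Q \<Longrightarrow> card C = n"
    and "\<And>C x. C \<in> Q \<Longrightarrow> x < v \<Longrightarrow> card {j \<in> C. x \<in> D ! j} = k div m"
    and "b = v" "r = k"
proof -
  obtain E where E: "mset E = mset D"
    and RD: "rectangular_design v b r k l1 l2 l3 m n (dual_design v E)"
    using dual by (auto simp: self_dual_RD_def)
  have SR: "semi_regular_II_RD v b r k l1 l2 l3 m n (dual_design v E)"
    using D RD by (simp add: semi_regular_II_RD_def)
  have n: "n > 0" and v: "v = m * n" and BD: "block_design v b r k D" and m: "m > 0"
    and b: "length D = b"
    using D by (auto simp: semi_regular_II_RD_def rectangular_design_def block_design_def)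
  have bv: "b = v"
    using RD by (auto simp: rectangular_design_def block_design_def)
  have rk: "r = k"
    using block_design_count[OF BD] bv m n v by simp
  \<comment> \<open>The array orders the blocks as in \<open>E\<close>, while
    \<open>resolvable\<close> speaks of positions in \<open>D\<close>; \<open>f\<close> carries each
    position of \<open>E\<close> to one of \<open>D\<close> holding the same block.\<close>
  obtain f where f: "bij_betw f {..<length E} {..<length D}"
    and nth: "\<And>j. j < length E \<Longrightarrow> E ! j = D ! f j"
    using permutation_Ex_bij[OF E] by blast
  have lenE: "length E = v"
    using mset_eq_length[OF E] b bv by simp
  have inj: "inj_on f {..<v}" and img: "f ` {..<v} = {..<b}"
    using f lenE b by (auto simp: bij_betw_def)
  let ?Q = "(`) f ` array_rows m n"
  have sub: "C \<subseteq> {..<v}" if "C \<in> array_rows m n" for C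
    using that array_row_subset v by (auto simp: array_rows_def)
  have part: "partition_on {..<b} ?Q"
  proof -
    have "{} \<notin> ?Q"
      using partition_onD3[OF partition_on_array_rows[OF n, of m]] by auto
    then show ?thesis
      using partition_on_inj_image[OF partition_on_array_rows[OF n, of m], of f] inj img v
      by simp
  qed
  \<comment> \<open>Distinct rows have distinct images under \<open>f\<close>, so no two classes
    merge.\<close>
  have "inj_on ((`) f) (array_rows m n)"
    using inj sub by (meson inj_onI inj_on_image_eq_iff)
  then have cQ: "card ?Q = m"
    using card_array_rows[OF n] by (simp add: card_image)
  have cC: "card C = n" if "C \<in> ?Q" for C
  proof -
    obtain i where i: "i < m" "C = f ` array_row n i"
      using \<open>C \<in> ?Q\<close> by (auto simp: array_rows_def)
    then show ?thesis
      using inj_on_subset[OF inj] array_row_subset v by (simp add: card_image)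
  qed
  have res: "card {j \<in> C. x \<in> D ! j} = k div m" if "C \<in> ?Q" "x < v" for C x
  proof -
    obtain i where i: "i < m" "C = f ` array_row n i"
      using \<open>C \<in> ?Q\<close> by (auto simp: array_rows_def)
    have row: "array_row n i \<subseteq> {..<v}"
      using array_row_subset[OF i(1)] v by simp
    have "{j \<in> C. x \<in> D ! j} = f ` {j \<in> array_row n i. x \<in> E ! j}"
      using i(2) row nth lenE by auto
    also have "card \<dots> = card {j \<in> array_row n i. x \<in> E ! j}"
      using row by (intro card_image inj_on_subset[OF inj]) auto
    also have "{j \<in> array_row n i. x \<in> E ! j} = dual_design v E ! x \<inter> array_row n i"
      using that(2) row lenE by (auto simp: nth_dual_design)
    also have "card \<dots> = k div m"
      using semi_regular_II_RD_alpha(3)[OF SR] that(2) i(1) by simp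
    finally show ?thesis .
  qed
  show thesis
    using that[OF part cQ cC res bv rk] by blast
qed

section \<open>Deleting rows of the array\<close>

text \<open>The first \<open>p\<close> rows are the initial segment below \<open>p * n\<close>, so
  surviving treatments keep their row, column, replication and concurrences. Of the thetas only
  \<open>theta1\<close> depends on the number of rows.\<close>

lemma semi_regular_II_RD_delete_rows:
  assumes D: "semi_regular_II_RD v b r k l1 l2 l3 m n D" and p: "p > 0" "p \<le> m"
  shows "semi_regular_II_RD (p * n) b r (k div m * p) l1 l2 l3 p n
    (map (\<lambda>B. B \<inter> {..<p * n}) D)" (is "semi_regular_II_RD _ _ _ _ _ _ _ _ _ ?D")
proof -
  have n: "n > 0" and v: "v = m * n" and BD: "block_design v b r k D"
    and RD: "rectangular_design v b r k l1 l2 l3 m n D"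
    and t: "theta2 r l1 l2 l3 n = 0" "theta1 r l1 l2 l3 m > 0" "theta3 r l1 l2 l3 > 0"
    using D by (auto simp: semi_regular_II_RD_def rectangular_design_def)
  have le: "p * n \<le> v"
    using p(2) v by simp
  have "card (B \<inter> {..<p * n}) = k div m * p" if "B \<in> set D" for B
  proof -
    have "card (B \<inter> {..<p * n}) = (\<Sum>i<p. card (B \<inter> {..<p * n} \<inter> array_row n i))"
      using n by (intro card_eq_sum_array_rows) auto
    also have "\<dots> = (\<Sum>i<p. card (B \<inter> array_row n i))"
      using array_row_subset[of _ p n] by (intro sum.cong arg_cong[of _ _ card]) auto
    also have "\<dots> = (\<Sum>i<p. k div m)"
      using semi_regular_II_RD_alpha(3)[OF D that] p(2) by (intro sum.cong) auto
    finally show ?thesis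
      by (simp add: mult.commute)
  qed
  moreover have "length (filter (\<lambda>B. x \<in> B) ?D) = r" if "x < p * n" for x
    using that BD le by (simp add: block_design_def filter_map comp_def)
  ultimately have BD': "block_design (p * n) b r (k div m * p) ?D"
    using BD by (auto simp: block_design_def)
  have "concurrence ?D x y =
      (if x div n = y div n then l1 else if x mod n = y mod n then l2 else l3)"
    if "x < p * n" "y < p * n" "x \<noteq> y" for x y
  proof -
    have "concurrence ?D x y = concurrence D x y"
      using that by (simp add: concurrence_def filter_map comp_def)
    moreover have "x < v" "y < v"
      using that le by auto
    ultimately show ?thesis
      using RD that(3) unfolding rectangular_design_def by simp
  qed
  then have RD': "rectangular_design (p * n) b r (k div m * p) l1 l2 l3 p n ?D"
    using BD' p(1) n by (simp add: rectangular_design_def)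
  \<comment> \<open>\<open>theta1\<close> is affine in the number of rows, with value
    \<open>theta3\<close> at 0 and a positive value at \<open>m\<close>, hence positive in between.
    The cases are the sign of the slope \<open>l2 - l3\<close>.\<close>
  have "theta1 r l1 l2 l3 p > 0"
  proof (cases "l2 \<ge> l3")
    case True
    then have "(int p - 1) * (int l2 - int l3) \<ge> 0"
      using p(1) by simp
    then show ?thesis
      using t(3) True by (simp add: theta1_def theta3_def)
  next
    case False
    then have "(int m - int p) * (int l3 - int l2) \<ge> 0"
      using p(2) by simp
    then show ?thesis
      using t(2) by (simp add: theta1_def algebra_simps)
  qed
  then show ?thesis
    using RD' t by (simp add: semi_regular_II_RD_def)
qed

section \<open>Assembly of the five claims\<close>

theorem theorem1:
  fixes v b r k l1 l2 l3 m n :: nat and D :: "nat set list"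
  assumes "semi_regular_II_RD v b r k l1 l2 l3 m n D"
  shows "m dvd k \<and>
    (let \<alpha> = k div m in
       (\<forall>B\<in>set D. \<forall>i<m. card (B \<inter> array_row n i) = \<alpha>) \<and>
       uniform_column_tactical_decomposable_wrt (array_rows m n) v D \<and>
       resolvable \<alpha> b v k r (dual_design v D) \<and>
       (self_dual_RD v b r k l1 l2 l3 m n D \<longrightarrow> resolvable \<alpha> v b r k D \<and> STD m n D) \<and>
       (self_dual_RD v b r k l1 l2 l3 m n D \<longrightarrow>
          (\<forall>s\<in>{1..m - 1}. \<exists>b' r' D'.
             semi_regular_II_RD ((m - s) * n) b' r' (\<alpha> * (m - s)) l1 l2 l3 (m - s) n D' \<and>
             resolvable \<alpha> ((m - s) * n) b' r' (\<alpha> * (m - s)) D')))"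
proof -
  define \<alpha> where "\<alpha> = k div m"
  have n: "n > 0" and v: "v = m * n" and BD: "block_design v b r k D" and b: "length D = b"
    using assms by (auto simp: semi_regular_II_RD_def rectangular_design_def block_design_def)
  note \<alpha> = semi_regular_II_RD_alpha[OF assms, folded \<alpha>_def]
  \<comment> \<open>For (ii) one class of all columns suffices; it is nonempty because
    \<open>b > 0\<close>.\<close>
  have "partition_on {..<b} {{..<b}}"
    using semi_regular_II_RD_pos(1)[OF assms] by (intro partition_on_space) auto
  then have uniform: "uniform_column_tactical_decomposable_wrt (array_rows m n) v D"
    unfolding uniform_column_tactical_decomposable_wrt_def
    using semi_regular_II_RD_column_tactical[OF assms] by blast
  \<comment> \<open>(iv) and (v) rest on the same partition \<open>Q\<close> of the block positions,
    hence the joint statement.\<close>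
  have self_dual: "resolvable \<alpha> v b r k D \<and> STD m n D \<and>
      (\<forall>s\<in>{1..m - 1}. \<exists>b' r' D'.
         semi_regular_II_RD ((m - s) * n) b' r' (\<alpha> * (m - s)) l1 l2 l3 (m - s) n D' \<and>
         resolvable \<alpha> ((m - s) * n) b' r' (\<alpha> * (m - s)) D')"
    if dual: "self_dual_RD v b r k l1 l2 l3 m n D"
  proof -
    obtain Q where Q: "partition_on {..<b} Q" "card Q = m" "\<And>C. C \<in> Q \<Longrightarrow> card C = n"
      "\<And>C x. C \<in> Q \<Longrightarrow> x < v \<Longrightarrow> card {j \<in> C. x \<in> D ! j} = \<alpha>" and rk: "r = k"
      using self_dual_RD_resolution[OF assms dual] unfolding \<alpha>_def by blast
    have sub: "C \<subseteq> {..<b}" if "C \<in> Q" for C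
      using that Q(1) by (auto simp: partition_on_def)
    have "\<forall>C\<in>Q. card C * k = v * \<alpha> \<and> (\<forall>x<v. card {j \<in> C. x \<in> D ! j} = \<alpha>)"
      using Q(3,4) \<alpha>(2) v by (metis mult.assoc mult.commute)
    then have "resolvable \<alpha> v b r k D"
      unfolding resolvable_def using BD \<alpha>(1,2) rk Q(1,2) by blast
    moreover have "STD m n D"
    proof -
      have ct: "column_tactical (incidence_matrix v D) (array_rows m n) Q (\<lambda>_ _. \<alpha>)"
        unfolding \<alpha>_def using assms Q(1) by (rule semi_regular_II_RD_column_tactical)
      have "(\<Sum>j\<in>C. incidence_matrix v D $$ (x, j)) = \<alpha>"
        if "R \<in> array_rows m n" "C \<in> Q" "x \<in> R" for R C x
      proof -
        have "x < v"
          using that Union_array_rows[OF n, of m] v by blast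
        then show ?thesis
          using sub[OF that(2)] Q(4)[OF that(2)] b by (simp add: incidence_matrix_row_sum)
      qed
      \<comment> \<open>The row sums over a class are exactly what resolvability counts.\<close>
      then have "row_tactical (incidence_matrix v D) (array_rows m n) Q (\<lambda>_ _. \<alpha>)"
        using ct by (auto simp: row_tactical_def column_tactical_def)
      then show ?thesis
        using ct Q(3) v by (auto simp: STD_def tactical_def)
    qed
    moreover have "\<exists>b' r' D'.
         semi_regular_II_RD ((m - s) * n) b' r' (\<alpha> * (m - s)) l1 l2 l3 (m - s) n D' \<and>
         resolvable \<alpha> ((m - s) * n) b' r' (\<alpha> * (m - s)) D'" if s: "s \<in> {1..m - 1}" for s
    proof -
      define p where "p = m - s"
      have p: "p > 0" "p \<le> m"
        using s by (auto simp: p_def)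
      let ?D = "map (\<lambda>B. B \<inter> {..<p * n}) D"
      have SR: "semi_regular_II_RD (p * n) b r (\<alpha> * p) l1 l2 l3 p n ?D"
        unfolding \<alpha>_def using assms p by (rule semi_regular_II_RD_delete_rows)
      have "card {j \<in> C. x \<in> ?D ! j} = \<alpha>" if "C \<in> Q" "x < p * n" for C x
      proof -
        have "{j \<in> C. x \<in> ?D ! j} = {j \<in> C. x \<in> D ! j}"
          using sub[OF that(1)] b that(2) by auto
        moreover have "x < v"
          using that(2) p(2) v mult_le_mono1[of p m n] by linarith
        ultimately show ?thesis
          using Q(4)[OF that(1)] by simp
      qed
      \<comment> \<open>Deletion keeps the list positions, so \<open>Q\<close> serves again:
        \<open>card Q * \<alpha>\<close> is still \<open>r\<close>, and \<open>n\<close> blocks of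
        size \<open>\<alpha> * p\<close> cover \<open>p * n\<close> treatments \<alpha> times
        each.\<close>
      then have "resolvable \<alpha> (p * n) b r (\<alpha> * p) ?D"
        unfolding resolvable_def using SR \<alpha>(1,2) rk Q(1-3)
        by (auto simp: semi_regular_II_RD_def rectangular_design_def intro!: exI[of _ Q])
      then show ?thesis
        using SR unfolding p_def by blast
    qed
    ultimately show ?thesis
      by blast
  qed
  show ?thesis
    unfolding Let_def \<alpha>_def[symmetric]
    using semi_regular_II_RD_dvd[OF assms] \<alpha>(3) uniform self_dual
      semi_regular_II_RD_dual_resolvable[OF assms, folded \<alpha>_def] by blast
qed

end
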